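(* Let $a\ge 0$ and let $r>0$, $p>0$, $q$ and $r_0>0$, $p_0>0$, $q_0$ be continuous real functions on $[a,\infty)$ such that $$r\le r_0,\qquad p_0\le p,\qquad q_0\ge q$$ on $[a,\infty)$. Suppose that the first systems-focal point $\hat\mu_1^0(a)$ exists for the equation $(r_0(x)y'')''-(q_0(x)y')'=p_0(x)y$. Then the first systems-focal point $\hat\mu_1(a)$ exists for the equation $(r(x)y'')''-(q(x)y')'=p(x)y$, and $$a<\hat\mu_1(a)\le\hat\mu_1^0(a).$$
   Context: For an equation $(ry'')''-(qy')'=py$ put $y_1=ry''$ and $Ty=(ry'')'-qy'$. A solution is a function $y$ such that $y,y',y_1,Ty$ are continuously differentiable and $(Ty)'=py$. The (first) systems-focal point of $a$ for this equation is the smallest $b\in(a,\infty)$ for which there is a nontrivial solution with $y(a)=y_1(a)=y'(b)=Ty(b)=0$; it exists if such a $b$ exists. The systems-focal point for the equation with coefficients $r_0,p_0,q_0$ is defined in the same way with $r_0,p_0,q_0$ in place of $r,p,q$. *)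

theory Defs
  imports "HOL-Analysis.Analysis"
begin

text \<open>All functions live on the ray \<open>[a, \<infinity>)\<close>; derivatives are taken within \<open>{a..}\<close>,
  so at the endpoint \<open>a\<close> they are one-sided and values left of \<open>a\<close> play no role.\<close>

definition ray_deriv :: "real \<Rightarrow> (real \<Rightarrow> real) \<Rightarrow> real \<Rightarrow> real" where
  "ray_deriv a f x = vector_derivative f (at x within {a..})"

definition C1_on_ray :: "real \<Rightarrow> (real \<Rightarrow> real) \<Rightarrow> bool" where
  "C1_on_ray a f \<longleftrightarrow> f differentiable_on {a..} \<and> continuous_on {a..} (ray_deriv a f)"

text \<open>The quasi-derivatives \<open>y\<^sub>1 = r y''\<close> and \<open>T y = (r y'')' - q y'\<close>.\<close>

definition quasi_y1 :: "real \<Rightarrow> (real \<Rightarrow> real) \<Rightarrow> (real \<Rightarrow> real) \<Rightarrow> real \<Rightarrow> real" where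
  "quasi_y1 a r y x = r x * ray_deriv a (ray_deriv a y) x"

definition quasi_T ::
  "real \<Rightarrow> (real \<Rightarrow> real) \<Rightarrow> (real \<Rightarrow> real) \<Rightarrow> (real \<Rightarrow> real) \<Rightarrow> real \<Rightarrow> real" where
  "quasi_T a r q y x = ray_deriv a (quasi_y1 a r y) x - q x * ray_deriv a y x"

text \<open>Solutions of \<open>(r y'')'' - (q y')' = p y\<close> on the ray. Since \<open>r\<close> and \<open>q\<close> need not be
  differentiable, the equation is read as \<open>(T y)' = p y\<close>.\<close>

definition ray_solution ::
  "real \<Rightarrow> (real \<Rightarrow> real) \<Rightarrow> (real \<Rightarrow> real) \<Rightarrow> (real \<Rightarrow> real) \<Rightarrow> (real \<Rightarrow> real) \<Rightarrow> bool" where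
  "ray_solution a r q p y \<longleftrightarrow>
     C1_on_ray a y \<and> C1_on_ray a (ray_deriv a y) \<and>
     C1_on_ray a (quasi_y1 a r y) \<and> C1_on_ray a (quasi_T a r q y) \<and>
     (\<forall>x\<ge>a. ray_deriv a (quasi_T a r q y) x = p x * y x)"

definition systems_focal_point ::
  "real \<Rightarrow> (real \<Rightarrow> real) \<Rightarrow> (real \<Rightarrow> real) \<Rightarrow> (real \<Rightarrow> real) \<Rightarrow> real \<Rightarrow> bool" where
  "systems_focal_point a r q p b \<longleftrightarrow>
     a < b \<and>
     (\<exists>y. ray_solution a r q p y \<and> (\<exists>x\<ge>a. y x \<noteq> 0) \<and>
          y a = 0 \<and> quasi_y1 a r y a = 0 \<and>
          ray_deriv a y b = 0 \<and> quasi_T a r q y b = 0)"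

definition is_first_systems_focal_point ::
  "real \<Rightarrow> (real \<Rightarrow> real) \<Rightarrow> (real \<Rightarrow> real) \<Rightarrow> (real \<Rightarrow> real) \<Rightarrow> real \<Rightarrow> bool" where
  "is_first_systems_focal_point a r q p \<mu> \<longleftrightarrow>
     systems_focal_point a r q p \<mu> \<and> (\<forall>b. systems_focal_point a r q p b \<longrightarrow> \<mu> \<le> b)"

end

theory Submission
  imports Defs
begin

text \<open>Pair the solution data as \<open>X = (y', T y)\<close> and \<open>U = (y\<^sub>1, y)\<close>. The equation then reads
  \<open>X' = B U\<close>, \<open>U' = C X\<close> with the symmetric matrices \<open>B = diag (1/r, p)\<close> and \<open>C = ((q, 1), (1, 0))\<close>:
  it is a linear Hamiltonian system with \<open>B\<close> positive definite, and a systems-focal point is a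
  \<open>b > a\<close> at which a nontrivial solution with \<open>U(a) = 0\<close> satisfies \<open>X(b) = 0\<close>. The hypotheses say
  exactly \<open>B\<^sup>-\<^sup>1 \<le> B\<^sub>0\<^sup>-\<^sup>1\<close> and \<open>C \<le> C\<^sub>0\<close>, so the theorem is the Sturm comparison theorem for such
  systems.

  Solutions with \<open>U(a) = 0\<close> form a plane. Choosing the basis with \<open>X(a) = I\<close>, the focal points are
  the zeros beyond \<open>a\<close> of the determinant of the \<open>2 \<times> 2\<close> matrix \<open>X\<close> (\<open>focal_point_iff\<close>). It is
  continuous with value \<open>1\<close> at \<open>a\<close>, so as soon as there is a focal point there is a first one
  (\<open>first_focal_point_exists\<close>).

  It remains to find a focal point of the first equation in \<open>(a, \<mu>\<^sub>0]\<close>. If there were none, \<open>X\<close> would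
  be invertible on \<open>[a, \<mu>\<^sub>0]\<close>. Let \<open>\<eta> = (y', T y)\<close> and \<open>\<zeta>\<^sub>0 = (y\<^sub>1, y)\<close> come from the solution \<open>y\<close> of
  the second equation that witnesses \<open>\<mu>\<^sub>0\<close>. Write \<open>\<eta> = X c\<close> with a vector function \<open>c\<close>, and put
  \<open>\<zeta> = U c\<close>. Because the basis is conjoined (\<open>X\<^sup>T U\<close> is symmetric), \<open>F = \<zeta> \<bullet> \<eta> - \<zeta>\<^sub>0 \<bullet> \<eta>\<close>
  satisfies Picone's identity
  \<open>F' = - \<eta> \<bullet> (C\<^sub>0 - C) \<eta> - \<eta>' \<bullet> (B\<^sub>0\<^sup>-\<^sup>1 - B\<^sup>-\<^sup>1) \<eta>' - (X c') \<bullet> B\<^sup>-\<^sup>1 (X c') \<le> 0\<close>,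
  while \<open>F(a) = 0\<close> since \<open>\<zeta>\<close> and \<open>\<zeta>\<^sub>0\<close> vanish there, and \<open>F(\<mu>\<^sub>0) = 0\<close> since \<open>\<eta>\<close> does. Hence
  \<open>F' = 0\<close>, so \<open>X c' = 0\<close>, \<open>c\<close> is constant and equal to \<open>c(\<mu>\<^sub>0) = 0\<close>. All initial data of \<open>y\<close> at
  \<open>a\<close> are then zero, and \<open>y\<close> is trivial (\<open>focal_det_nonzero_imp_trivial\<close>).

  Both the basis and the last conclusion rest on the linear initial value problem on a ray:
  existence by Picard's series (\<open>linear_ivp_exists\<close>) and uniqueness by an energy estimate
  (\<open>linear_ivp_zero_unique\<close>).\<close>

section \<open>Linear initial value problems on a ray\<close>

lemma at_within_ray_eq:
  fixes x :: real
  assumes "x < c"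
  shows "at x within {a..} = at x within {a..c}"
  by (rule at_within_nhd[of x "{..<c}"]) (use assms in auto)

lemma has_derivative_ray_integral:
  fixes f :: "real \<Rightarrow> 'e::banach"
  assumes f: "continuous_on {a..} f" and x: "a \<le> x"
  shows "((\<lambda>t. integral {a..t} f) has_vector_derivative f x) (at x within {a..})"
proof -
  have "((\<lambda>t. integral {a..t} f) has_vector_derivative f x) (at x within {a..x + 1})"
    by (rule integral_has_vector_derivative) (use x in \<open>auto intro: continuous_on_subset[OF f]\<close>)
  then show ?thesis
    using at_within_ray_eq[of x "x + 1" a] by simp
qed

primrec picard_term ::
  "real \<Rightarrow> (real \<Rightarrow> 'e::banach \<Rightarrow>\<^sub>L 'e) \<Rightarrow> 'e \<Rightarrow> nat \<Rightarrow> real \<Rightarrow> 'e" where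
  "picard_term a A z0 0 = (\<lambda>t. z0)"
| "picard_term a A z0 (Suc k) = (\<lambda>t. integral {a..t} (\<lambda>s. A s (picard_term a A z0 k s)))"

lemma continuous_picard_term:
  assumes A: "continuous_on {a..} A"
  shows "continuous_on {a..} (picard_term a A z0 k)"
proof (induction k)
  case (Suc k)
  have "continuous_on {a..} (\<lambda>s. A s (picard_term a A z0 k s))"
    using A Suc by (intro continuous_intros)
  from has_derivative_ray_integral[OF this] show ?case
    by (auto intro!: continuous_on_vector_derivative)
qed simp

lemma has_derivative_picard_term:
  assumes A: "continuous_on {a..} A" and x: "a \<le> x"
  shows "(picard_term a A z0 (Suc k) has_vector_derivative A x (picard_term a A z0 k x))
           (at x within {a..})"
proof -
  have "continuous_on {a..} (\<lambda>s. A s (picard_term a A z0 k s))"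
    using A continuous_picard_term[OF A] by (intro continuous_intros)
  from has_derivative_ray_integral[OF this x] show ?thesis by simp
qed

text \<open>The factorial comes from integrating the bound for the previous term: the majorant
  \<open>\<phi>\<^sub>k\<close> on the right satisfies \<open>\<phi>\<^sub>k\<^sub>+\<^sub>1' = L \<phi>\<^sub>k\<close>. It makes the Picard series converge uniformly on
  every bounded interval, however large \<open>L\<close> is.\<close>

lemma norm_picard_term_le:
  assumes A: "continuous_on {a..} A"
    and L: "\<And>s. a \<le> s \<Longrightarrow> s \<le> c \<Longrightarrow> norm (A s) \<le> L" and t: "a \<le> t" "t \<le> c"
  shows "norm (picard_term a A z0 k t) \<le> norm z0 * ((L * (t - a)) ^ k / fact k)"
  using t
proof (induction k arbitrary: t)
  case (Suc k)
  let ?d = "picard_term a A z0"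
  let ?\<phi> = "\<lambda>k t. norm z0 * ((L * (t - a)) ^ k / fact k)"
  have "0 \<le> L"
    using L[of a] Suc.prems norm_ge_zero[of "A a"] by linarith
  show ?case
  proof (cases "a < t")
    case True
    have "norm (?d (Suc k) t - ?d (Suc k) a) \<le> ?\<phi> (Suc k) t - ?\<phi> (Suc k) a"
    proof (rule differentiable_bound_general[OF True])
      show "continuous_on {a..t} (?d (Suc k))"
        by (rule continuous_on_subset[OF continuous_picard_term[OF A]]) auto
      show "continuous_on {a..t} (?\<phi> (Suc k))"
        by (intro continuous_intros) auto
      fix x assume x: "a < x" "x < t"
      have "at x within {a..} = at x"
        using x by (intro at_within_interior) (simp add: interior_real_atLeast)
      then show "(?d (Suc k) has_vector_derivative A x (?d k x)) (at x)"
        using has_derivative_picard_term[OF A, of x z0 k] x by simp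
      have "(?\<phi> (Suc k) has_real_derivative L * ?\<phi> k x) (at x)"
      proof -
        have "(?\<phi> (Suc k) has_real_derivative
                norm z0 * (of_nat (Suc k) * (L * (x - a)) ^ k * L / fact (Suc k))) (at x)"
          by (auto intro!: derivative_eq_intros simp del: fact_Suc of_nat_Suc power_Suc)
        moreover have "of_nat (Suc k) / fact (Suc k) = (1 / fact k :: real)"
          by (simp del: of_nat_Suc)
        then have "norm z0 * (of_nat (Suc k) * (L * (x - a)) ^ k * L / fact (Suc k))
            = L * ?\<phi> k x"
          by (simp del: of_nat_Suc)
        ultimately show ?thesis by (simp only:)
      qed
      then show "(?\<phi> (Suc k) has_vector_derivative L * ?\<phi> k x) (at x)"
        by (simp add: has_real_derivative_iff_has_vector_derivative)
      have "norm (A x (?d k x)) \<le> norm (A x) * norm (?d k x)"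
        by (rule norm_blinfun)
      also have "\<dots> \<le> L * ?\<phi> k x"
        using x Suc.prems L[of x] Suc.IH[of x] \<open>0 \<le> L\<close> by (intro mult_mono) auto
      finally show "norm (A x (?d k x)) \<le> L * ?\<phi> k x" .
    qed
    then show ?thesis by simp
  qed (use Suc.prems in auto)
qed simp

text \<open>The solution is the sum of all Picard terms. By linearity the term-wise derivatives are
  \<open>A\<close> applied to the terms themselves, so they sum up to \<open>A\<close> applied to the solution. The argument
  is run on \<open>[a, x + 1]\<close> for each \<open>x\<close>; the extra unit puts \<open>x\<close> inside the interval, where
  derivatives within the interval and within the ray agree.\<close>

lemma linear_ivp_exists:
  fixes A :: "real \<Rightarrow> 'e::banach \<Rightarrow>\<^sub>L 'e"
  assumes A: "continuous_on {a..} A"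
  obtains z where "z a = z0"
    and "\<And>x. a \<le> x \<Longrightarrow> (z has_vector_derivative A x (z x)) (at x within {a..})"
proof -
  let ?d = "picard_term a A z0"
  define z where "z t = (\<Sum>k. ?d k t)" for t
  have "?d k a = 0" if "k > 0" for k
    using that by (cases k) auto
  then have "(\<lambda>k. ?d k a) sums (\<Sum>k\<in>{0}. ?d k a)"
    by (intro sums_finite) auto
  then have "(\<lambda>k. ?d k a) sums z0" by simp
  then have "z a = z0"
    by (simp add: z_def sums_iff)
  moreover have "(z has_vector_derivative A x (z x)) (at x within {a..})" if x: "a \<le> x" for x
  proof -
    define S where "S = {a..x + 1}"
    have "compact (A ` S)"
      by (rule compact_continuous_image) (auto simp: S_def intro: continuous_on_subset[OF A])
    then obtain L where "L > 0" and L: "\<And>s. s \<in> S \<Longrightarrow> norm (A s) \<le> L"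
      using compact_imp_bounded[of "A ` S"] by (auto simp: bounded_pos)
    define M where "M k = norm z0 * ((L * (x + 1 - a)) ^ k / fact k)" for k
    have d_le: "norm (?d k t) \<le> M k" if "t \<in> S" for k t
    proof -
      have "norm (?d k t) \<le> norm z0 * ((L * (t - a)) ^ k / fact k)"
        using that by (intro norm_picard_term_le[OF A, where c = "x + 1"] L) (auto simp: S_def)
      also have "\<dots> \<le> M k"
        unfolding M_def using that \<open>L > 0\<close>
        by (intro mult_left_mono divide_right_mono power_mono) (auto simp: S_def)
      finally show ?thesis .
    qed
    have "summable M"
      unfolding M_def using summable_exp_generic[of "L * (x + 1 - a)"]
      by (intro summable_mult) (simp add: field_simps)
    from d_le this have unif: "uniform_limit S (\<lambda>n t. \<Sum>k<n. ?d k t) z sequentially"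
      unfolding z_def by (rule Weierstrass_m_test)
    have summ: "summable (\<lambda>k. ?d k t)" if "t \<in> S" for t
      by (rule summable_comparison_test[OF _ \<open>summable M\<close>]) (use d_le[OF that] in blast)
    have "\<exists>g. \<forall>t\<in>S. (\<lambda>k. ?d (Suc k) t) sums g t
              \<and> (g has_derivative (\<lambda>h. h *\<^sub>R A t (z t))) (at t within S)"
    proof (rule has_derivative_series)
      show "convex S" by (simp add: S_def)
      show "a \<in> S" using x by (simp add: S_def)
      show "(\<lambda>k. ?d (Suc k) a) sums 0" by simp
      show "(?d (Suc k) has_derivative (\<lambda>h. h *\<^sub>R A t (?d k t))) (at t within S)"
        if "t \<in> S" for k t
        using has_derivative_picard_term[OF A, of t z0 k] that
        by (auto simp: has_vector_derivative_def S_def intro: has_derivative_subset)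
      show "\<forall>\<^sub>F n in sequentially. \<forall>t\<in>S. \<forall>h.
          norm ((\<Sum>k<n. h *\<^sub>R A t (?d k t)) - h *\<^sub>R A t (z t)) \<le> e * norm h"
        if "e > 0" for e
      proof -
        have "\<forall>\<^sub>F n in sequentially. \<forall>t\<in>S. dist (\<Sum>k<n. ?d k t) (z t) < e / L"
          using unif \<open>e > 0\<close> \<open>L > 0\<close> by (auto simp: uniform_limit_iff)
        then show ?thesis
        proof (rule eventually_mono, intro ballI allI)
          fix n t and h :: real
          assume close: "\<forall>t\<in>S. dist (\<Sum>k<n. ?d k t) (z t) < e / L" and t: "t \<in> S"
          have "(\<Sum>k<n. h *\<^sub>R A t (?d k t)) - h *\<^sub>R A t (z t) =
                h *\<^sub>R A t ((\<Sum>k<n. ?d k t) - z t)"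
            by (simp add: blinfun.diff_right blinfun.sum_right scaleR_sum_right scaleR_diff_right)
          also have "norm \<dots> \<le> norm h * (norm (A t) * norm ((\<Sum>k<n. ?d k t) - z t))"
            by (simp add: mult_left_mono norm_blinfun)
          also have "\<dots> \<le> norm h * (L * (e / L))"
            using close t L[OF t] \<open>L > 0\<close>
            by (intro mult_left_mono mult_mono) (auto simp: dist_norm less_imp_le)
          finally show "norm ((\<Sum>k<n. h *\<^sub>R A t (?d k t)) - h *\<^sub>R A t (z t)) \<le> e * norm h"
            using \<open>L > 0\<close> by (simp add: mult.commute)
        qed
      qed
    qed
    then obtain g where g: "\<And>t. t \<in> S \<Longrightarrow> (\<lambda>k. ?d (Suc k) t) sums g t"
      and g': "\<And>t. t \<in> S \<Longrightarrow> (g has_vector_derivative A t (z t)) (at t within S)"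
      by (auto simp: has_vector_derivative_def)
    \<comment> \<open>\<open>g\<close> sums the terms from index 1 on; term 0 is the constant \<open>z0\<close>.\<close>
    have z_eq: "z t = z0 + g t" if "t \<in> S" for t
      using suminf_split_head[OF summ[OF that]] g[OF that] by (simp add: z_def sums_iff algebra_simps)
    have xS: "x \<in> S" using x by (simp add: S_def)
    have "((\<lambda>t. z0 + g t) has_vector_derivative A x (z x)) (at x within S)"
      by (auto intro!: derivative_eq_intros g' xS)
    from has_vector_derivative_transform[OF xS _ this, of z]
    have "(z has_vector_derivative A x (z x)) (at x within S)"
      by (simp add: z_eq)
    then show "(z has_vector_derivative A x (z x)) (at x within {a..})"
      using at_within_ray_eq[of x "x + 1" a] by (simp add: S_def)
  qed
  ultimately show thesis by (rule that)
qed

text \<open>If \<open>L\<close> bounds \<open>\<parallel>A\<parallel>\<close> on \<open>[a, x]\<close>, the squared norm of a solution grows at most like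
  \<open>exp (2 L t)\<close>; dividing by this factor gives a nonincreasing function, which starts at zero.\<close>

lemma linear_ivp_zero_unique:
  fixes A :: "real \<Rightarrow> 'e::real_inner \<Rightarrow>\<^sub>L 'e"
  assumes A: "continuous_on {a..} A"
    and z: "\<And>x. a \<le> x \<Longrightarrow> (z has_vector_derivative A x (z x)) (at x within {a..})"
    and za: "z a = 0" and x: "a \<le> x"
  shows "z x = 0"
proof -
  have "compact (A ` {a..x})"
    by (rule compact_continuous_image) (auto intro: continuous_on_subset[OF A])
  then obtain L where L: "\<And>s. a \<le> s \<Longrightarrow> s \<le> x \<Longrightarrow> norm (A s) \<le> L"
    using compact_imp_bounded[of "A ` {a..x}"] by (force simp: bounded_iff)
  let ?N = "\<lambda>t. exp (- 2 * L * t) * (z t \<bullet> z t)"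
  have "?N x \<le> ?N a"
  proof (rule DERIV_nonpos_imp_decreasing_open[OF x])
    have "continuous_on {a..} z"
      using z by (auto intro!: continuous_on_vector_derivative)
    then show "continuous_on {a..x} ?N"
      by (intro continuous_intros) (auto elim: continuous_on_subset)
    fix t assume t: "a < t" "t < x"
    have "at t within {a..} = at t"
      using t by (intro at_within_interior) (simp add: interior_real_atLeast)
    then have zt: "(z has_vector_derivative A t (z t)) (at t)"
      using z[of t] t by simp
    have "((\<lambda>t. z t \<bullet> z t) has_real_derivative 2 * (z t \<bullet> A t (z t))) (at t)"
      using bounded_bilinear.has_vector_derivative[OF bounded_bilinear_inner zt zt]
      by (simp add: has_real_derivative_iff_has_vector_derivative inner_commute)
    then have D: "(?N has_real_derivative
        2 * exp (- 2 * L * t) * (z t \<bullet> A t (z t) - L * (z t \<bullet> z t))) (at t)"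
      by (auto intro!: derivative_eq_intros simp: algebra_simps)
    have "z t \<bullet> A t (z t) \<le> norm (z t) * norm (A t (z t))"
      by (rule norm_cauchy_schwarz)
    also have "\<dots> \<le> norm (z t) * (L * norm (z t))"
      using norm_blinfun[of "A t" "z t"] L[of t] t
      by (meson less_imp_le mult_left_mono mult_right_mono norm_ge_zero order_trans)
    also have "\<dots> = L * (z t \<bullet> z t)"
      by (simp add: dot_square_norm power2_eq_square)
    finally have "2 * exp (- 2 * L * t) * (z t \<bullet> A t (z t) - L * (z t \<bullet> z t)) \<le> 0"
      by (simp add: mult_nonneg_nonpos)
    with D show "\<exists>y. (?N has_real_derivative y) (at t) \<and> y \<le> 0" by blast
  qed
  then have "exp (- 2 * L * x) * (z x \<bullet> z x) \<le> 0"
    using za by simp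
  then have "z x \<bullet> z x \<le> 0"
    by (simp add: mult_le_0_iff)
  then show ?thesis
    using inner_ge_zero[of "z x"] by (metis antisym inner_eq_zero_iff)
qed

section \<open>Calculus with one-sided derivatives on the ray\<close>

lemma vector_derivative_ray:
  fixes a :: real
  assumes "(f has_vector_derivative D) (at x within {a..})" and "a \<le> x"
  shows "vector_derivative f (at x within {a..}) = D"
proof (rule vector_derivative_within[OF _ assms(1)])
  have "x islimpt {x<..<x + 1}"
    by (rule islimpt_greaterThanLessThan1) simp
  then have "x islimpt {a..}"
    by (rule islimpt_subset) (use \<open>a \<le> x\<close> in auto)
  then show "at x within {a..} \<noteq> bot"
    by (simp add: trivial_limit_within)
qed

text \<open>A function and its formula need only agree on the ray: left of \<open>a\<close> the one-sided derivative
  is an unspecified value, so an iterated derivative matches its formula only on the ray.\<close>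

lemma ray_deriv_eqI:
  assumes "\<And>t. a \<le> t \<Longrightarrow> g t = f t"
    and "(f has_real_derivative D) (at x within {a..})" and "a \<le> x"
  shows "ray_deriv a g x = D"
  unfolding ray_deriv_def
proof (rule vector_derivative_ray[OF _ \<open>a \<le> x\<close>])
  show "(g has_vector_derivative D) (at x within {a..})"
    using assms has_vector_derivative_transform[of x "{a..}" g f D]
    by (auto simp: has_real_derivative_iff_has_vector_derivative)
qed

lemma C1_on_ray_has_derivative:
  assumes "C1_on_ray a f" and "a \<le> x"
  shows "(f has_real_derivative ray_deriv a f x) (at x within {a..})"
  using assms
  by (auto simp: C1_on_ray_def differentiable_on_def ray_deriv_def vector_derivative_works
      has_real_derivative_iff_has_vector_derivative)

lemma C1_on_rayI:
  assumes eq: "\<And>x. a \<le> x \<Longrightarrow> g x = f x"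
    and f: "\<And>x. a \<le> x \<Longrightarrow> (f has_real_derivative f' x) (at x within {a..})"
    and f': "continuous_on {a..} f'"
  shows "C1_on_ray a g"
  unfolding C1_on_ray_def
proof
  have "(g has_vector_derivative f' x) (at x within {a..})" if "a \<le> x" for x
    using that eq f[OF that] has_vector_derivative_transform[of x "{a..}" g f "f' x"]
    by (auto simp: has_real_derivative_iff_has_vector_derivative)
  then show "g differentiable_on {a..}"
    by (auto simp: differentiable_on_def intro: differentiableI_vector)
  show "continuous_on {a..} (ray_deriv a g)"
    using f' continuous_on_cong[of "{a..}" "{a..}" "ray_deriv a g" f'] ray_deriv_eqI[OF eq f]
    by simp
qed

section \<open>The Hamiltonian form of the equation\<close>

text \<open>The system \<open>X' = B U\<close>, \<open>U' = C X\<close> for \<open>X = (v, T)\<close> and \<open>U = (m, y)\<close>, where \<open>v\<close>, \<open>T\<close> and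
  \<open>m\<close> stand for \<open>y'\<close>, \<open>T y\<close> and \<open>y\<^sub>1 = r y''\<close>.\<close>

definition hamiltonian_solution ::
  "real \<Rightarrow> (real \<Rightarrow> real) \<Rightarrow> (real \<Rightarrow> real) \<Rightarrow> (real \<Rightarrow> real) \<Rightarrow>
   (real \<Rightarrow> real) \<Rightarrow> (real \<Rightarrow> real) \<Rightarrow> (real \<Rightarrow> real) \<Rightarrow> (real \<Rightarrow> real) \<Rightarrow> bool" where
  "hamiltonian_solution a r q p v T m y \<longleftrightarrow> (\<forall>x\<ge>a.
     (v has_real_derivative m x / r x) (at x within {a..}) \<and>
     (T has_real_derivative p x * y x) (at x within {a..}) \<and>
     (m has_real_derivative T x + q x * v x) (at x within {a..}) \<and>
     (y has_real_derivative v x) (at x within {a..}))"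

lemma hamiltonian_solution_lincomb:
  assumes "hamiltonian_solution a r q p v1 T1 m1 y1"
    and "hamiltonian_solution a r q p v2 T2 m2 y2"
  shows "hamiltonian_solution a r q p
    (\<lambda>x. c * v1 x + d * v2 x) (\<lambda>x. c * T1 x + d * T2 x)
    (\<lambda>x. c * m1 x + d * m2 x) (\<lambda>x. c * y1 x + d * y2 x)"
  using assms unfolding hamiltonian_solution_def
  by (auto intro!: derivative_eq_intros simp: algebra_simps add_divide_distrib)

lemma hamiltonian_solution_continuous:
  assumes "hamiltonian_solution a r q p v T m y"
  shows "continuous_on {a..} v" "continuous_on {a..} T"
    "continuous_on {a..} m" "continuous_on {a..} y"
  using assms unfolding hamiltonian_solution_def
  by (auto intro!: DERIV_continuous_on)

locale quasi_equation =
  fixes a :: real and r q p :: "real \<Rightarrow> real"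
  assumes cont_r: "continuous_on {a..} r" and cont_q: "continuous_on {a..} q"
    and cont_p: "continuous_on {a..} p"
    and r_pos: "\<And>x. a \<le> x \<Longrightarrow> 0 < r x" and p_pos: "\<And>x. a \<le> x \<Longrightarrow> 0 < p x"
begin

definition system_matrix :: "real \<Rightarrow> (real \<times> real \<times> real \<times> real) \<Rightarrow>\<^sub>L (real \<times> real \<times> real \<times> real)" where
  "system_matrix t = Blinfun (\<lambda>(v, T, m, y). (m / r t, p t * y, T + q t * v, v))"

lemma system_matrix_apply:
  "system_matrix t (v, T, m, y) = (m / r t, p t * y, T + q t * v, v)"
proof -
  have "linear (\<lambda>(v, T, m, y). (m / r t, p t * y, T + q t * v, v))"
    by (rule linearI) (auto simp: algebra_simps add_divide_distrib)
  then show ?thesis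
    unfolding system_matrix_def
    by (simp add: bounded_linear_Blinfun_apply linear_conv_bounded_linear)
qed

lemma continuous_system_matrix: "continuous_on {a..} system_matrix"
proof (rule continuous_on_blinfun_componentwise)
  fix i :: "real \<times> real \<times> real \<times> real"
  obtain v T m y where i: "i = (v, T, m, y)" by (cases i)
  have "r x \<noteq> 0" if "x \<in> {a..}" for x
    using r_pos[of x] that by auto
  then show "continuous_on {a..} (\<lambda>x. system_matrix x i)"
    unfolding i system_matrix_apply
    by (intro continuous_intros cont_r cont_q cont_p) auto
qed

lemma hamiltonian_solution_exists:
  obtains v T m y where "hamiltonian_solution a r q p v T m y"
    and "v a = v0" "T a = T0" "m a = m0" "y a = y0"
proof -
  obtain z where za: "z a = (v0, T0, m0, y0)" and
    z: "\<And>x. a \<le> x \<Longrightarrow> (z has_vector_derivative system_matrix x (z x)) (at x within {a..})"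
    using linear_ivp_exists[OF continuous_system_matrix, where ?z0.0 = "(v0, T0, m0, y0)"] by blast
  let ?v = "\<lambda>x. fst (z x)" and ?T = "\<lambda>x. fst (snd (z x))"
    and ?m = "\<lambda>x. fst (snd (snd (z x)))" and ?y = "\<lambda>x. snd (snd (snd (z x)))"
  have "hamiltonian_solution a r q p ?v ?T ?m ?y"
    unfolding hamiltonian_solution_def has_real_derivative_iff_has_vector_derivative
  proof (intro allI impI)
    fix x assume "a \<le> x"
    have Az: "system_matrix x (z x) = (?m x / r x, p x * ?y x, ?T x + q x * ?v x, ?v x)"
      using system_matrix_apply[of x "?v x" "?T x" "?m x" "?y x"] by simp
    note D1 = z[OF \<open>a \<le> x\<close>, unfolded Az]
    note D2 = bounded_linear.has_vector_derivative[OF bounded_linear_snd D1]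
    note D3 = bounded_linear.has_vector_derivative[OF bounded_linear_snd D2]
    show "(?v has_vector_derivative ?m x / r x) (at x within {a..}) \<and>
      (?T has_vector_derivative p x * ?y x) (at x within {a..}) \<and>
      (?m has_vector_derivative ?T x + q x * ?v x) (at x within {a..}) \<and>
      (?y has_vector_derivative ?v x) (at x within {a..})"
      using D1[THEN bounded_linear.has_vector_derivative[OF bounded_linear_fst]]
        D2[THEN bounded_linear.has_vector_derivative[OF bounded_linear_fst]]
        D3[THEN bounded_linear.has_vector_derivative[OF bounded_linear_fst]]
        D3[THEN bounded_linear.has_vector_derivative[OF bounded_linear_snd]]
      by simp
  qed
  then show thesis by (rule that) (simp_all add: za)
qed

lemma hamiltonian_solution_zero:
  assumes sol: "hamiltonian_solution a r q p v T m y"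
    and "v a = 0" "T a = 0" "m a = 0" "y a = 0" and x: "a \<le> x"
  shows "v x = 0" "T x = 0" "m x = 0" "y x = 0"
proof -
  let ?z = "\<lambda>x. (v x, T x, m x, y x)"
  have "(?z has_vector_derivative system_matrix x (?z x)) (at x within {a..})" if "a \<le> x" for x
    using sol that unfolding hamiltonian_solution_def system_matrix_apply
    by (auto simp: has_real_derivative_iff_has_vector_derivative
        intro!: has_vector_derivative_Pair)
  from linear_ivp_zero_unique[OF continuous_system_matrix this _ x]
  have "?z x = 0"
    using assms by (simp add: zero_prod_def)
  then show "v x = 0" "T x = 0" "m x = 0" "y x = 0"
    by (simp_all add: zero_prod_def)
qed

lemma ray_solution_hamiltonian:
  assumes "ray_solution a r q p y"
  shows "hamiltonian_solution a r q p (ray_deriv a y) (quasi_T a r q y) (quasi_y1 a r y) y"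
  unfolding hamiltonian_solution_def
proof (intro allI impI)
  fix x assume x: "a \<le> x"
  let ?v = "ray_deriv a y" and ?T = "quasi_T a r q y" and ?m = "quasi_y1 a r y"
  have "ray_deriv a ?v x = ?m x / r x"
    using r_pos[OF x] by (simp add: quasi_y1_def)
  moreover have "ray_deriv a ?T x = p x * y x"
    using assms x by (simp add: ray_solution_def)
  moreover have "ray_deriv a ?m x = ?T x + q x * ?v x"
    by (simp add: quasi_T_def)
  ultimately show "(?v has_real_derivative ?m x / r x) (at x within {a..}) \<and>
      (?T has_real_derivative p x * y x) (at x within {a..}) \<and>
      (?m has_real_derivative ?T x + q x * ?v x) (at x within {a..}) \<and>
      (y has_real_derivative ?v x) (at x within {a..})"
    using assms x unfolding ray_solution_def by (metis C1_on_ray_has_derivative)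
qed

text \<open>The quasi-derivatives of \<open>y\<close> are recovered from the system one after the other; the
  hypothesis \<open>r > 0\<close> is what turns \<open>v' = m / r\<close> back into \<open>m = r y''\<close>.\<close>

lemma hamiltonian_ray_solution:
  assumes "hamiltonian_solution a r q p v T m y"
  shows "ray_solution a r q p y"
    and "\<And>x. a \<le> x \<Longrightarrow> ray_deriv a y x = v x"
    and "\<And>x. a \<le> x \<Longrightarrow> quasi_T a r q y x = T x"
    and "\<And>x. a \<le> x \<Longrightarrow> quasi_y1 a r y x = m x"
proof -
  note cont = hamiltonian_solution_continuous[OF assms]
  have D: "(v has_real_derivative m x / r x) (at x within {a..})"
    "(T has_real_derivative p x * y x) (at x within {a..})"
    "(m has_real_derivative T x + q x * v x) (at x within {a..})"
    "(y has_real_derivative v x) (at x within {a..})" if "a \<le> x" for x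
    using assms that by (auto simp: hamiltonian_solution_def)
  show v: "ray_deriv a y x = v x" if "a \<le> x" for x
    by (rule ray_deriv_eqI[OF refl D(4)[OF that] that])
  have v': "ray_deriv a (ray_deriv a y) x = m x / r x" if "a \<le> x" for x
    by (rule ray_deriv_eqI[OF v D(1)[OF that] that])
  show m: "quasi_y1 a r y x = m x" if "a \<le> x" for x
    using r_pos[OF that] by (simp add: quasi_y1_def v'[OF that])
  have m': "ray_deriv a (quasi_y1 a r y) x = T x + q x * v x" if "a \<le> x" for x
    by (rule ray_deriv_eqI[OF m D(3)[OF that] that])
  show T: "quasi_T a r q y x = T x" if "a \<le> x" for x
    by (simp add: quasi_T_def m'[OF that] v[OF that])
  have T': "ray_deriv a (quasi_T a r q y) x = p x * y x" if "a \<le> x" for x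
    by (rule ray_deriv_eqI[OF T D(2)[OF that] that])
  have "r x \<noteq> 0" if "x \<in> {a..}" for x
    using r_pos[of x] that by auto
  then have cont': "continuous_on {a..} (\<lambda>x. m x / r x)"
    by (intro continuous_intros cont cont_r) auto
  have "C1_on_ray a y"
    by (rule C1_on_rayI[OF refl D(4) cont(1)])
  moreover have "C1_on_ray a (ray_deriv a y)"
    by (rule C1_on_rayI[OF v D(1) cont'])
  moreover have "C1_on_ray a (quasi_y1 a r y)"
    by (rule C1_on_rayI[OF m D(3)]) (auto intro!: continuous_intros cont cont_q)
  moreover have "C1_on_ray a (quasi_T a r q y)"
    by (rule C1_on_rayI[OF T D(2)]) (auto intro!: continuous_intros cont cont_p)
  ultimately show "ray_solution a r q p y"
    using T' by (simp add: ray_solution_def)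
qed

end

section \<open>Focal points as zeros of a determinant\<close>

text \<open>Two solutions with \<open>U(a) = 0\<close> and \<open>X(a) = I\<close>; they span the solutions that satisfy the
  boundary conditions at \<open>a\<close>.\<close>

locale focal_basis = quasi_equation +
  fixes v1 T1 m1 y1 v2 T2 m2 y2 :: "real \<Rightarrow> real"
  assumes sol1: "hamiltonian_solution a r q p v1 T1 m1 y1"
    and sol2: "hamiltonian_solution a r q p v2 T2 m2 y2"
    and init1: "v1 a = 1" "T1 a = 0" "m1 a = 0" "y1 a = 0"
    and init2: "v2 a = 0" "T2 a = 1" "m2 a = 0" "y2 a = 0"
begin

definition focal_det :: "real \<Rightarrow> real" where
  "focal_det x = v1 x * T2 x - v2 x * T1 x"

lemma focal_solution_in_span:
  assumes sol: "hamiltonian_solution a r q p v T m y" and "m a = 0" "y a = 0" and x: "a \<le> x"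
  shows "v x = v a * v1 x + T a * v2 x" "T x = v a * T1 x + T a * T2 x"
    "y x = v a * y1 x + T a * y2 x"
proof -
  note comb = hamiltonian_solution_lincomb[OF sol1 sol2, of "v a" "T a"]
  note diff = hamiltonian_solution_lincomb[OF sol comb, of 1 "-1"]
  show "v x = v a * v1 x + T a * v2 x" "T x = v a * T1 x + T a * T2 x"
    "y x = v a * y1 x + T a * y2 x"
    using hamiltonian_solution_zero[OF diff _ _ _ _ x] assms init1 init2 by simp_all
qed

text \<open>A solution satisfying the conditions at \<open>a\<close> is \<open>c\<close> times the first plus \<open>d\<close> times the second
  basis solution, and the conditions at \<open>b\<close> say that \<open>(c, d)\<close> lies in the kernel of the matrix
  \<open>X(b)\<close>.\<close>

lemma focal_point_iff:
  "systems_focal_point a r q p b \<longleftrightarrow> a < b \<and> focal_det b = 0"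
proof (intro iffI conjI)
  assume "systems_focal_point a r q p b"
  then obtain y where "a < b" and y: "ray_solution a r q p y" and nz: "\<exists>x\<ge>a. y x \<noteq> 0"
    and bc: "y a = 0" "quasi_y1 a r y a = 0" "ray_deriv a y b = 0" "quasi_T a r q y b = 0"
    by (auto simp: systems_focal_point_def)
  then show "a < b" by simp
  let ?c = "ray_deriv a y a" and ?d = "quasi_T a r q y a"
  note span = focal_solution_in_span[OF ray_solution_hamiltonian[OF y] bc(2,1)]
  have "?c \<noteq> 0 \<or> ?d \<noteq> 0"
    using nz span(3) by auto
  moreover have eqs: "?c * v1 b + ?d * v2 b = 0" "?c * T1 b + ?d * T2 b = 0"
    using span(1,2)[of b] bc \<open>a < b\<close> by simp_all
  \<comment> \<open>Cramer's rule\<close>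
  have "?c * focal_det b = T2 b * (?c * v1 b + ?d * v2 b) - v2 b * (?c * T1 b + ?d * T2 b)"
    "?d * focal_det b = v1 b * (?c * T1 b + ?d * T2 b) - T1 b * (?c * v1 b + ?d * v2 b)"
    by (simp_all add: focal_det_def algebra_simps)
  then have "?c * focal_det b = 0" "?d * focal_det b = 0"
    unfolding eqs by simp_all
  ultimately show "focal_det b = 0" by auto
next
  assume b: "a < b \<and> focal_det b = 0"
  have "\<exists>c d. (c \<noteq> 0 \<or> d \<noteq> 0) \<and> c * v1 b + d * v2 b = 0 \<and> c * T1 b + d * T2 b = 0"
  proof -
    consider "v1 b \<noteq> 0 \<or> v2 b \<noteq> 0" | "T1 b \<noteq> 0 \<or> T2 b \<noteq> 0"
      | "v1 b = 0" "v2 b = 0" "T1 b = 0" "T2 b = 0" by blast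
    then show ?thesis
    proof cases
      case 1
      then show ?thesis
        using b by (intro exI[of _ "- v2 b"] exI[of _ "v1 b"])
          (auto simp: focal_det_def algebra_simps)
    next
      case 2
      then show ?thesis
        using b by (intro exI[of _ "- T2 b"] exI[of _ "T1 b"])
          (auto simp: focal_det_def algebra_simps)
    next
      case 3
      then show ?thesis by (intro exI[of _ 1]) simp
    qed
  qed
  then obtain c d where nz: "c \<noteq> 0 \<or> d \<noteq> 0"
    and vb: "c * v1 b + d * v2 b = 0" and Tb: "c * T1 b + d * T2 b = 0" by blast
  \<comment> \<open>Triviality of this combination would force \<open>c = y'(a) = 0\<close> and \<open>d = T y (a) = 0\<close>.\<close>
  note comb = hamiltonian_solution_lincomb[OF sol1 sol2, of c d]
  let ?y = "\<lambda>x. c * y1 x + d * y2 x"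
  note Y = hamiltonian_ray_solution[OF comb]
  have "\<exists>x\<ge>a. ?y x \<noteq> 0"
  proof (rule ccontr)
    assume "\<not> ?thesis"
    then have y0: "?y x = 0" if "a \<le> x" for x
      using that by blast
    have v0: "ray_deriv a ?y x = 0" if "a \<le> x" for x
      by (rule ray_deriv_eqI[OF y0 _ that]) simp_all
    have "ray_deriv a (ray_deriv a ?y) x = 0" if "a \<le> x" for x
      by (rule ray_deriv_eqI[OF v0 _ that]) simp_all
    then have m0: "quasi_y1 a r ?y x = 0" if "a \<le> x" for x
      using that by (simp add: quasi_y1_def)
    have "ray_deriv a (quasi_y1 a r ?y) a = 0"
      by (rule ray_deriv_eqI[OF m0 _ order_refl]) simp_all
    then have "quasi_T a r q ?y a = 0"
      using v0[of a] by (simp add: quasi_T_def)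
    then show False
      using nz Y(2,3)[of a] v0[of a] init1 init2 by simp
  qed
  then show "systems_focal_point a r q p b"
    unfolding systems_focal_point_def
    using b Y(1) Y(2,3)[of b] Y(4)[of a] vb Tb init1 init2
    by (intro conjI exI[of _ ?y]) auto
qed

text \<open>The zeros of the determinant form a closed set that does not contain \<open>a\<close>.\<close>

lemma first_focal_point_exists:
  assumes "systems_focal_point a r q p b"
  obtains \<mu> where "is_first_systems_focal_point a r q p \<mu>"
proof -
  let ?Z = "{a..b} \<inter> focal_det -` {0}"
  have "continuous_on {a..} focal_det"
    unfolding focal_det_def
    by (intro continuous_intros hamiltonian_solution_continuous[OF sol1]
        hamiltonian_solution_continuous[OF sol2])
  then have "closed ?Z"
    by (intro continuous_closed_preimage) (auto elim: continuous_on_subset)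
  then have "compact ?Z"
    by (metis Int_absorb1 Int_lower1 bounded_closed_interval bounded_subset compact_eq_bounded_closed)
  moreover have "b \<in> ?Z"
    using assms by (auto simp: focal_point_iff)
  ultimately obtain \<mu> where \<mu>: "\<mu> \<in> ?Z" "\<And>x. x \<in> ?Z \<Longrightarrow> \<mu> \<le> x"
    using compact_attains_inf[of ?Z] by blast
  have "focal_det a = 1"
    by (simp add: focal_det_def init1 init2)
  have \<mu>': "focal_det \<mu> = 0" "a \<le> \<mu>"
    using \<mu>(1) by simp_all
  then have "a < \<mu>"
    using \<open>focal_det a = 1\<close> by (cases "a = \<mu>") simp_all
  moreover have "\<mu> \<le> x" if "a < x" "focal_det x = 0" for x
    using \<mu>(2)[of x] \<mu>(2)[OF \<open>b \<in> ?Z\<close>] that by (cases "x \<le> b") simp_all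
  ultimately have "is_first_systems_focal_point a r q p \<mu>"
    using \<mu>' unfolding is_first_systems_focal_point_def focal_point_iff by blast
  then show thesis by (rule that)
qed

text \<open>The two sides are the off-diagonal entries of \<open>X\<^sup>T U\<close>. Their difference is constant because \<open>B\<close> and
  \<open>C\<close> are symmetric, and it vanishes at \<open>a\<close>.\<close>

lemma conjoined:
  assumes "a \<le> x"
  shows "v1 x * m2 x + T1 x * y2 x = v2 x * m1 x + T2 x * y1 x"
proof -
  let ?W = "\<lambda>x. v1 x * m2 x + T1 x * y2 x - (v2 x * m1 x + T2 x * y1 x)"
  have "(?W has_real_derivative 0) (at t within {a..})" if "t \<in> {a..}" for t
    using sol1 sol2 that unfolding hamiltonian_solution_def
    by (auto intro!: derivative_eq_intros simp: algebra_simps)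
  then have "\<exists>c. \<forall>t\<in>{a..}. ?W t = c"
    by (intro has_field_derivative_zero_constant) auto
  then have "?W x = ?W a" using assms by auto
  then show ?thesis by (simp add: init1 init2)
qed

end

lemma (in quasi_equation) focal_basis_exists:
  obtains v1 T1 m1 y1 v2 T2 m2 y2
  where "focal_basis a r q p v1 T1 m1 y1 v2 T2 m2 y2"
proof -
  obtain v1 T1 m1 y1 where 1: "hamiltonian_solution a r q p v1 T1 m1 y1"
    "v1 a = 1" "T1 a = 0" "m1 a = 0" "y1 a = 0"
    by (rule hamiltonian_solution_exists)
  obtain v2 T2 m2 y2 where 2: "hamiltonian_solution a r q p v2 T2 m2 y2"
    "v2 a = 0" "T2 a = 1" "m2 a = 0" "y2 a = 0"
    by (rule hamiltonian_solution_exists)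
  have "focal_basis a r q p v1 T1 m1 y1 v2 T2 m2 y2"
    by unfold_locales (fact 1 2)+
  then show thesis by (rule that)
qed

section \<open>Comparison by Picone's identity\<close>

text \<open>The heart of the comparison. In the notation of the introduction, the vectors \<open>(V, T)\<close>,
  \<open>(M, Y)\<close> and \<open>(m, y)\<close> are \<open>\<eta>\<close>, \<open>\<zeta>\<^sub>0\<close> and \<open>\<zeta>\<close>, and \<open>(w\<^sub>1, w\<^sub>2) = \<eta>' - B \<zeta>\<close> equals
  \<open>X (c', d')\<close>. The function \<open>Q\<close> is the sum of nonnegative terms with \<open>F' = - Q\<close>.\<close>

lemma (in focal_basis) focal_det_nonzero_imp_trivial:
  assumes big: "quasi_equation a r0 q0 p0"
    and r_le: "\<And>x. a \<le> x \<Longrightarrow> r x \<le> r0 x" and p_le: "\<And>x. a \<le> x \<Longrightarrow> p0 x \<le> p x"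
    and q_le: "\<And>x. a \<le> x \<Longrightarrow> q x \<le> q0 x"
    and sol: "hamiltonian_solution a r0 q0 p0 V T M Y"
    and left: "M a = 0" "Y a = 0" and right: "V b = 0" "T b = 0" and "a < b"
    and det: "\<And>x. a \<le> x \<Longrightarrow> x \<le> b \<Longrightarrow> focal_det x \<noteq> 0"
  shows "V a = 0" "T a = 0"
proof -
  interpret big: quasi_equation a r0 q0 p0 by (rule big)
  \<comment> \<open>Cramer's rule for \<open>\<eta> = X (c, d)\<close>\<close>
  define c where "c x = (V x * T2 x - v2 x * T x) / focal_det x" for x
  define d where "d x = (v1 x * T x - T1 x * V x) / focal_det x" for x
  have VT: "v1 x * c x + v2 x * d x = V x" "T1 x * c x + T2 x * d x = T x"
    if "a \<le> x" "x \<le> b" for x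
    using det[OF that]
    by (simp_all add: c_def d_def focal_det_def add_divide_distrib[symmetric] divide_eq_eq)
      (simp_all add: algebra_simps)
  define m where "m x = c x * m1 x + d x * m2 x" for x
  define y where "y x = c x * y1 x + d x * y2 x" for x
  define w1 where "w1 x = M x / r0 x - m x / r x" for x
  define w2 where "w2 x = p0 x * Y x - p x * y x" for x
  \<comment> \<open>Differentiating \<open>\<eta> = X (c, d)\<close> leaves \<open>X (c', d') = \<eta>' - B \<zeta>\<close>, solved here by Cramer's rule.\<close>
  define c' where "c' x = (w1 x * T2 x - v2 x * w2 x) / focal_det x" for x
  define d' where "d' x = (v1 x * w2 x - T1 x * w1 x) / focal_det x" for x
  define F where "F x = m x * V x + y x * T x - (M x * V x + Y x * T x)" for x
  define Q where "Q x = (q0 x - q x) * (V x)\<^sup>2 + (r0 x - r x) * (M x / r0 x)\<^sup>2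
    + (1 / p0 x - 1 / p x) * (p0 x * Y x)\<^sup>2 + r x * (w1 x)\<^sup>2 + (w2 x)\<^sup>2 / p x" for x

  have cont: "continuous_on {a..b} c" "continuous_on {a..b} d"
    using hamiltonian_solution_continuous[OF sol1] hamiltonian_solution_continuous[OF sol2]
      hamiltonian_solution_continuous[OF sol] det
    unfolding c_def d_def focal_det_def
    by (auto intro!: continuous_intros elim: continuous_on_subset)
  have cont_F: "continuous_on {a..b} F"
    using hamiltonian_solution_continuous[OF sol1] hamiltonian_solution_continuous[OF sol2]
      hamiltonian_solution_continuous[OF sol] cont
    unfolding F_def m_def y_def
    by (auto intro!: continuous_intros elim: continuous_on_subset)

  have derivs: "(c has_real_derivative c' x) (at x)" "(d has_real_derivative d' x) (at x)"
    "(F has_real_derivative - Q x) (at x)" if x: "a < x" "x < b" for x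
  proof -
    have at: "at x within {a..} = at x"
      using x by (intro at_within_interior) (simp add: interior_real_atLeast)
    have D1: "(v1 has_real_derivative m1 x / r x) (at x)"
      "(T1 has_real_derivative p x * y1 x) (at x)"
      "(m1 has_real_derivative T1 x + q x * v1 x) (at x)"
      "(y1 has_real_derivative v1 x) (at x)"
      using sol1[unfolded hamiltonian_solution_def, rule_format, of x] x unfolding at by auto
    have D2: "(v2 has_real_derivative m2 x / r x) (at x)"
      "(T2 has_real_derivative p x * y2 x) (at x)"
      "(m2 has_real_derivative T2 x + q x * v2 x) (at x)"
      "(y2 has_real_derivative v2 x) (at x)"
      using sol2[unfolded hamiltonian_solution_def, rule_format, of x] x unfolding at by auto
    have D: "(V has_real_derivative M x / r0 x) (at x)"
      "(T has_real_derivative p0 x * Y x) (at x)"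
      "(M has_real_derivative T x + q0 x * V x) (at x)"
      "(Y has_real_derivative V x) (at x)"
      using sol[unfolded hamiltonian_solution_def, rule_format, of x] x unfolding at by auto
    have pos: "r x > 0" "p x > 0" "r0 x > 0" "p0 x > 0"
      using x r_pos p_pos big.r_pos big.p_pos by auto
    have nz: "focal_det x \<noteq> 0" using det x by simp
    let ?\<Delta>' = "m1 x / r x * T2 x + v1 x * (p x * y2 x) - (m2 x / r x * T1 x + v2 x * (p x * y1 x))"
    have Ddet: "(focal_det has_real_derivative ?\<Delta>') (at x)"
      unfolding focal_det_def
      by (auto intro!: derivative_eq_intros D1 D2 simp: algebra_simps)
    have num: "V x * T2 x - v2 x * T x = c x * focal_det x"
      "v1 x * T x - T1 x * V x = d x * focal_det x"
      using nz by (simp_all add: c_def d_def)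
    have VTx: "V x = v1 x * c x + v2 x * d x" "T x = T1 x * c x + T2 x * d x"
      using VT[of x] x by simp_all
    have quot: "((e + k * h) * focal_det x - k * focal_det x * h) / (focal_det x * focal_det x)
        = e / focal_det x" for e k h
      using nz by (simp add: field_simps)
    \<comment> \<open>The left sides are the derivatives of the numerators of \<open>c\<close> and \<open>d\<close>, split so that the
      quotient rule cancels the derivative of the determinant.\<close>
    have Nc: "M x / r0 x * T2 x + V x * (p x * y2 x) - (m2 x / r x * T x + v2 x * (p0 x * Y x))
        = w1 x * T2 x - v2 x * w2 x + c x * ?\<Delta>'"
      unfolding VTx w1_def w2_def m_def y_def by (simp add: algebra_simps add_divide_distrib)
    have Nd: "m1 x / r x * T x + v1 x * (p0 x * Y x) - (p x * y1 x * V x + T1 x * (M x / r0 x))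
        = v1 x * w2 x - T1 x * w1 x + d x * ?\<Delta>'"
      unfolding VTx w1_def w2_def m_def y_def by (simp add: algebra_simps add_divide_distrib)
    have "((\<lambda>x. V x * T2 x - v2 x * T x) has_real_derivative
        w1 x * T2 x - v2 x * w2 x + c x * ?\<Delta>') (at x)"
      unfolding Nc[symmetric] by (auto intro!: derivative_eq_intros D D2)
    from DERIV_divide[OF this Ddet nz] show Dc: "(c has_real_derivative c' x) (at x)"
      unfolding num quot by (simp only: c_def[abs_def] c'_def)
    have "((\<lambda>x. v1 x * T x - T1 x * V x) has_real_derivative
        v1 x * w2 x - T1 x * w1 x + d x * ?\<Delta>') (at x)"
      unfolding Nd[symmetric] by (auto intro!: derivative_eq_intros D D1)
    from DERIV_divide[OF this Ddet nz] show Dd: "(d has_real_derivative d' x) (at x)"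
      unfolding num quot by (simp only: d_def[abs_def] d'_def)
    have Xw: "v1 x * c' x + v2 x * d' x = w1 x" "T1 x * c' x + T2 x * d' x = w2 x"
      using nz
      by (simp_all add: c'_def d'_def focal_det_def add_divide_distrib[symmetric] divide_eq_eq)
        (simp_all add: algebra_simps)
    have "(F has_real_derivative
        (c' x * m1 x + d' x * m2 x + (T x + q x * V x)) * V x + m x * (M x / r0 x)
        + ((c' x * y1 x + d' x * y2 x + V x) * T x + y x * (p0 x * Y x))
        - ((T x + q0 x * V x) * V x + M x * (M x / r0 x) + (V x * T x + Y x * (p0 x * Y x)))) (at x)"
      (is "(F has_real_derivative ?F') (at x)")
    proof -
      have "(m has_real_derivative c' x * m1 x + d' x * m2 x + (T x + q x * V x)) (at x)"
        unfolding m_def[abs_def] VTx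
        by (auto intro!: derivative_eq_intros D1 D2 Dc Dd simp: algebra_simps)
      moreover have "(y has_real_derivative c' x * y1 x + d' x * y2 x + V x) (at x)"
        unfolding y_def[abs_def] VTx
        by (auto intro!: derivative_eq_intros D1 D2 Dc Dd simp: algebra_simps)
      ultimately show ?thesis
        unfolding F_def[abs_def] by (auto intro!: derivative_eq_intros D)
    qed
    moreover have "?F' = - Q x"
    proof -
      \<comment> \<open>\<open>(U (c', d')) \<bullet> \<eta> = (X (c', d')) \<bullet> \<zeta>\<close> holds because the basis is conjoined.\<close>
      have "(c' x * m1 x + d' x * m2 x) * V x + (c' x * y1 x + d' x * y2 x) * T x
            - (w1 x * m x + w2 x * y x)
          = (c' x * d x - d' x * c x) *
            (v2 x * m1 x + T2 x * y1 x - (v1 x * m2 x + T1 x * y2 x))"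
        unfolding VTx Xw[symmetric] m_def y_def by (simp add: algebra_simps)
      also have "\<dots> = 0"
        using conjoined[of x] x by simp
      finally have 1: "(c' x * m1 x + d' x * m2 x) * V x + (c' x * y1 x + d' x * y2 x) * T x
          = w1 x * m x + w2 x * y x" by simp
      \<comment> \<open>With \<open>(P, S) = \<eta>'\<close> and the reciprocals \<open>k\<close>, \<open>k0\<close>, both \<open>\<zeta>\<close> and \<open>\<zeta>\<^sub>0\<close> become polynomial
        expressions, and the rest is a polynomial identity.\<close>
      define P S k k0 where "P = M x / r0 x" and "S = p0 x * Y x" and "k = 1 / p x" and "k0 = 1 / p0 x"
      have subst: "M x = r0 x * P" "Y x = k0 * S" "m x = r x * (P - w1 x)" "y x = k * (S - w2 x)"
        using pos by (simp_all add: P_def S_def k_def k0_def w1_def w2_def field_simps)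
      have "?F' = (c' x * m1 x + d' x * m2 x) * V x + (c' x * y1 x + d' x * y2 x) * T x
          - (q0 x - q x) * (V x)\<^sup>2 + (m x - M x) * P + (y x - Y x) * S"
        unfolding P_def[symmetric] S_def[symmetric] by (simp add: algebra_simps power2_eq_square)
      also have "\<dots> = - ((q0 x - q x) * (V x)\<^sup>2 + (r0 x - r x) * P\<^sup>2 + (k0 - k) * S\<^sup>2
          + r x * (w1 x)\<^sup>2 + k * (w2 x)\<^sup>2)"
        unfolding 1 subst by (simp add: algebra_simps power2_eq_square)
      also have "\<dots> = - Q x"
        unfolding Q_def P_def S_def k_def k0_def by simp
      finally show ?thesis .
    qed
    ultimately show "(F has_real_derivative - Q x) (at x)" by simp
  qed

  have Q_terms: "0 \<le> (q0 x - q x) * (V x)\<^sup>2" "0 \<le> (r0 x - r x) * (M x / r0 x)\<^sup>2"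
    "0 \<le> (1 / p0 x - 1 / p x) * (p0 x * Y x)\<^sup>2" "0 \<le> r x * (w1 x)\<^sup>2" "0 \<le> (w2 x)\<^sup>2 / p x"
    if "a \<le> x" for x
    using r_le[OF that] p_le[OF that] q_le[OF that] r_pos[OF that] p_pos[OF that]
      big.p_pos[OF that]
    by (auto intro!: mult_nonneg_nonneg simp: frac_le)
  have Q_nonneg: "0 \<le> Q x" if "a \<le> x" for x
    using Q_terms[OF that] by (simp add: Q_def)
  have F_anti: "F t \<le> F s" if "a \<le> s" "s \<le> t" "t \<le> b" for s t
  proof (rule DERIV_nonpos_imp_decreasing_open[OF \<open>s \<le> t\<close>])
    show "continuous_on {s..t} F"
      using that by (intro continuous_on_subset[OF cont_F]) auto
  qed (use derivs(3) Q_nonneg that in \<open>force intro!: exI[of _ "- Q _"]\<close>)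
  have "F a = 0" "F b = 0"
    using left right by (simp_all add: F_def m_def y_def init1 init2)
  then have F_zero: "F x = 0" if "a \<le> x" "x \<le> b" for x
    using F_anti[of a x] F_anti[of x b] that \<open>a < b\<close> by simp
  \<comment> \<open>\<open>F\<close> vanishes on an interval, so \<open>Q = 0\<close> there, and the two terms of \<open>Q\<close> in \<open>w1\<close>, \<open>w2\<close> vanish.\<close>
  have cd': "c' x = 0 \<and> d' x = 0" if x: "a < x" "x < b" for x
  proof -
    have "- Q x = 0"
    proof (rule DERIV_local_const[OF derivs(3)[OF x]])
      show "0 < min (x - a) (b - x)" using x by simp
      show "\<forall>z. \<bar>x - z\<bar> < min (x - a) (b - x) \<longrightarrow> F x = F z"
        using F_zero x by auto
    qed
    then have "r x * (w1 x)\<^sup>2 = 0" "(w2 x)\<^sup>2 / p x = 0"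
      using Q_terms[of x] x unfolding Q_def by linarith+
    then have "w1 x = 0" "w2 x = 0"
      using r_pos[of x] p_pos[of x] x by auto
    then show ?thesis by (simp add: c'_def d'_def)
  qed
  have "c b = c a" "d b = d a"
    using DERIV_isconst2[OF \<open>a < b\<close> cont(1), of b] DERIV_isconst2[OF \<open>a < b\<close> cont(2), of b]
      derivs(1,2) cd' \<open>a < b\<close> by (auto; metis)+
  moreover have "c b = 0" "d b = 0"
    using right by (simp_all add: c_def d_def)
  ultimately show "V a = 0" "T a = 0"
    using VT[of a] \<open>a < b\<close> by auto
qed

section \<open>Comparison of the first focal points\<close>

theorem theorem3p5:
  fixes a :: real and r q p r0 q0 p0 :: "real \<Rightarrow> real"
  assumes "a \<ge> 0"
    and "continuous_on {a..} r" and "continuous_on {a..} q" and "continuous_on {a..} p"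
    and "continuous_on {a..} r0" and "continuous_on {a..} q0" and "continuous_on {a..} p0"
    and "\<And>x. x \<ge> a \<Longrightarrow> r x > 0" and "\<And>x. x \<ge> a \<Longrightarrow> p x > 0"
    and "\<And>x. x \<ge> a \<Longrightarrow> r0 x > 0" and "\<And>x. x \<ge> a \<Longrightarrow> p0 x > 0"
    and "\<And>x. x \<ge> a \<Longrightarrow> r x \<le> r0 x" and "\<And>x. x \<ge> a \<Longrightarrow> p0 x \<le> p x"
    and "\<And>x. x \<ge> a \<Longrightarrow> q0 x \<ge> q x"
    and "\<exists>b. systems_focal_point a r0 q0 p0 b"
  shows "\<exists>\<mu>0 \<mu>. is_first_systems_focal_point a r0 q0 p0 \<mu>0 \<and>
                is_first_systems_focal_point a r q p \<mu> \<and> a < \<mu> \<and> \<mu> \<le> \<mu>0"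
proof -
  interpret E: quasi_equation a r q p
    using assms by unfold_locales
  interpret E0: quasi_equation a r0 q0 p0
    using assms by unfold_locales
  obtain v1 T1 m1 y1 v2 T2 m2 y2 where B: "focal_basis a r q p v1 T1 m1 y1 v2 T2 m2 y2"
    by (rule E.focal_basis_exists)
  interpret B: focal_basis a r q p v1 T1 m1 y1 v2 T2 m2 y2 by (rule B)
  obtain \<mu>0 where \<mu>0: "is_first_systems_focal_point a r0 q0 p0 \<mu>0"
    using assms(15) E0.focal_basis_exists focal_basis.first_focal_point_exists by metis
  then have "systems_focal_point a r0 q0 p0 \<mu>0"
    by (simp add: is_first_systems_focal_point_def)
  then obtain y where "a < \<mu>0" and y: "ray_solution a r0 q0 p0 y" and nz: "\<exists>x\<ge>a. y x \<noteq> 0"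
    and bc: "y a = 0" "quasi_y1 a r0 y a = 0" "ray_deriv a y \<mu>0 = 0" "quasi_T a r0 q0 y \<mu>0 = 0"
    by (auto simp: systems_focal_point_def)
  note sol = E0.ray_solution_hamiltonian[OF y]
  have "\<exists>b. a \<le> b \<and> b \<le> \<mu>0 \<and> B.focal_det b = 0"
  proof (rule ccontr)
    assume "\<not> ?thesis"
    then have "ray_deriv a y a = 0" "quasi_T a r0 q0 y a = 0"
      using B.focal_det_nonzero_imp_trivial[OF E0.quasi_equation_axioms assms(12-14) sol
          bc(2,1,3,4) \<open>a < \<mu>0\<close>] by blast+
    then have "y x = 0" if "a \<le> x" for x
      using E0.hamiltonian_solution_zero(4)[OF sol _ _ bc(2,1) that] by simp
    with nz show False by blast
  qed
  then obtain b where b: "a \<le> b" "b \<le> \<mu>0" "B.focal_det b = 0" by blast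
  have "B.focal_det a = 1"
    by (simp add: B.focal_det_def B.init1 B.init2)
  with b have "a < b" by (cases "a = b") auto
  with b have foc: "systems_focal_point a r q p b"
    by (simp add: B.focal_point_iff)
  then obtain \<mu> where \<mu>: "is_first_systems_focal_point a r q p \<mu>"
    by (rule B.first_focal_point_exists)
  then have "a < \<mu>" "\<mu> \<le> b"
    using foc unfolding is_first_systems_focal_point_def systems_focal_point_def by blast+
  with \<mu>0 \<mu> b(2) show ?thesis by force
qed

end
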